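(* Let $k\in\mathbb{N}$ with $k\ge 1$ and $p\in[1,\infty]$. For $\mathbf{x}=(x_1,\dots,x_k)$ and $\mathbf{y}=(y_1,\dots,y_k)$ in $\mathbb{R}^k$ define $$d^p(\mathbf{x},\mathbf{y})=\Big(\big(\sum_{i:\,x_i\ge y_i}(x_i-y_i)\big)^p+\big(\sum_{i:\,x_i<y_i}(y_i-x_i)\big)^p\Big)^{1/p}$$ (for $p=\infty$, $d^\infty(\mathbf{x},\mathbf{y})$ is the maximum of the two sums). Then $(\mathbb{R}^k,d^p)$ is a metric space.
   Context: Empty sums are $0$. A metric $d$ is a real-valued function that is nonnegative, symmetric, satisfies $d(a,b)=0\iff a=b$, and satisfies the triangle inequality. *)

theory Defs
  imports "HOL-Analysis.Analysis"
begin

definition excess_sum :: "real ^ 'k \<Rightarrow> real ^ 'k \<Rightarrow> real" where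
  "excess_sum x y = (\<Sum>i | x $ i \<ge> y $ i. x $ i - y $ i)"

definition deficit_sum :: "real ^ 'k \<Rightarrow> real ^ 'k \<Rightarrow> real" where
  "deficit_sum x y = (\<Sum>i | x $ i < y $ i. y $ i - x $ i)"

(* The exponent is an extended real because p = \<infinity> is allowed; only p \<ge> 1 is meaningful.
   Both sums are nonnegative, and 0 powr a = 0, so powr is the usual power here. *)
definition dist_p :: "ereal \<Rightarrow> real ^ 'k \<Rightarrow> real ^ 'k \<Rightarrow> real" where
  "dist_p p x y =
     (if p = \<infinity> then max (excess_sum x y) (deficit_sum x y)
      else (excess_sum x y powr real_of_ereal p + deficit_sum x y powr real_of_ereal p)
             powr (1 / real_of_ereal p))"

end

theory Submission
  imports Defs
begin

text \<open>
  The two sums are sums over all coordinates of positive parts, hence subadditive, and exchanging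
  the points exchanges them; so \<open>d\<^sup>p\<close> is the planar \<open>\<ell>\<^sup>p\<close> norm of a pair of subadditive
  functions, and the triangle inequality follows from Minkowski's inequality in the plane.
\<close>

text \<open>Writing the summands as positive parts makes the index set independent of the points, so
  that sums for different pairs can be compared term by term.\<close>

lemma excess_sum_eq: "excess_sum x y = (\<Sum>i\<in>UNIV. max 0 (x $ i - y $ i))"
proof -
  have "excess_sum x y = (\<Sum>i\<in>UNIV. if x $ i \<ge> y $ i then x $ i - y $ i else 0)"
    unfolding excess_sum_def by (simp add: sum.If_cases)
  also have "\<dots> = (\<Sum>i\<in>UNIV. max 0 (x $ i - y $ i))"
    by (rule sum.cong) auto
  finally show ?thesis .
qed

text \<open>Coordinates with \<open>x $ i = y $ i\<close> contribute 0, so it does not matter which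
  of the two sums includes ties.\<close>

lemma deficit_sum_eq: "deficit_sum x y = excess_sum y x"
proof -
  have "deficit_sum x y = (\<Sum>i\<in>UNIV. if x $ i < y $ i then y $ i - x $ i else 0)"
    unfolding deficit_sum_def by (simp add: sum.If_cases)
  also have "\<dots> = (\<Sum>i\<in>UNIV. max 0 (y $ i - x $ i))"
    by (rule sum.cong) auto
  finally show ?thesis by (simp add: excess_sum_eq)
qed

lemma excess_sum_nonneg: "0 \<le> excess_sum x y"
  unfolding excess_sum_eq by (intro sum_nonneg) simp

text \<open>Each coordinate of \<open>x - z\<close> is the sum of those of \<open>x - y\<close> and
  \<open>y - z\<close>, and the positive part is subadditive.\<close>

lemma excess_sum_triangle: "excess_sum x z \<le> excess_sum x y + excess_sum y z"
  unfolding excess_sum_eq sum.distrib[symmetric] by (intro sum_mono) auto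

lemma excess_sum_eq_0_iff: "excess_sum x y = 0 \<longleftrightarrow> (\<forall>i. x $ i \<le> y $ i)"
proof -
  have "max 0 (a - b) = 0 \<longleftrightarrow> a \<le> b" for a b :: real by auto
  then show ?thesis unfolding excess_sum_eq by (subst sum_nonneg_eq_0_iff) auto
qed

lemma excess_sums_eq_0_iff: "excess_sum x y = 0 \<and> excess_sum y x = 0 \<longleftrightarrow> x = y"
  unfolding excess_sum_eq_0_iff vec_eq_iff by (auto intro: antisym)

text \<open>Adds the endpoint 0 to the convexity on the open half-line; it is needed because one of
  the two sums may vanish while the other does not.\<close>

lemma convex_on_powr_nonneg:
  fixes r :: real
  assumes "1 \<le> r"
  shows "convex_on {0..} (\<lambda>x. x powr r)"
proof (rule convex_onI)
  fix t x y :: real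
  assume t: "0 < t" "t < 1" and xy: "x \<in> {0..}" "y \<in> {0..}"
  \<comment> \<open>With one endpoint at 0, where the power is 0, convexity reduces to this
    inequality, which rests on \<open>u powr r \<le> u\<close> for \<open>u\<close> in the unit
    interval.\<close>
  have shrink: "(u * z) powr r \<le> u * z powr r" if "0 < u" "u < 1" "0 \<le> z" for u z :: real
  proof -
    have "u powr r \<le> u powr 1" using that assms by (intro powr_mono') auto
    then show ?thesis using that by (simp add: powr_mult mult_right_mono)
  qed
  consider "x = 0" | "y = 0" | "0 < x" "0 < y" using xy by force
  then show "((1 - t) *\<^sub>R x + t *\<^sub>R y) powr r \<le> (1 - t) * x powr r + t * y powr r"
  proof cases
    case 1
    then show ?thesis using shrink[of t y] t xy by simp
  next
    case 2
    then show ?thesis using shrink[of "1 - t" x] t xy by simp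
  next
    case 3
    then show ?thesis using convex_onD[OF powr_convex[OF assms], of t x y] t by simp
  qed
qed simp

text \<open>For nonnegative \<open>a\<close>, \<open>b\<close> and \<open>r \<ge> 1\<close> this is
  the planar \<ell>^r norm of \<open>(a, b)\<close>.\<close>

definition pnorm2 :: "real \<Rightarrow> real \<Rightarrow> real \<Rightarrow> real" where
  "pnorm2 r a b = (a powr r + b powr r) powr (1 / r)"

lemma pnorm2_nonneg: "0 \<le> pnorm2 r a b"
  by (simp add: pnorm2_def)

lemma pnorm2_eq_0_iff: "pnorm2 r a b = 0 \<longleftrightarrow> a = 0 \<and> b = 0"
  by (simp add: pnorm2_def add_nonneg_eq_0_iff)

lemma pnorm2_powr: "0 < r \<Longrightarrow> pnorm2 r a b powr r = a powr r + b powr r"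
  by (simp add: pnorm2_def powr_powr)

lemma pnorm2_mono:
  assumes "0 < r" "0 \<le> a" "0 \<le> b" "a \<le> a'" "b \<le> b'"
  shows "pnorm2 r a b \<le> pnorm2 r a' b'"
  unfolding pnorm2_def using assms by (intro powr_mono2 add_mono) auto

text \<open>After division by \<open>s + t\<close>, the sum vector is a convex combination of the
  two vectors scaled to norm 1. Convexity of the power in each coordinate then bounds the sum of its
  r-th powers by 1.\<close>

lemma minkowski_pnorm2:
  assumes r: "1 \<le> r" and nn: "0 \<le> a" "0 \<le> b" "0 \<le> c" "0 \<le> d"
  shows "pnorm2 r (a + c) (b + d) \<le> pnorm2 r a b + pnorm2 r c d"
proof (cases "pnorm2 r a b = 0 \<or> pnorm2 r c d = 0")
  case True
  \<comment> \<open>A vector of norm 0 is zero, so the claim is trivial; otherwise both norms may be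
    divided by.\<close>
  then show ?thesis
    by (auto simp: pnorm2_eq_0_iff pnorm2_nonneg)
next
  case False
  define s t where "s = pnorm2 r a b" and "t = pnorm2 r c d"
  have st: "0 < s" "0 < t"
    using False pnorm2_nonneg[of r] by (auto simp: s_def t_def less_le)
  \<comment> \<open>One coordinate of the convexity argument: the points \<open>u / s\<close> and
    \<open>v / t\<close> carry the weights \<open>s / (s + t)\<close> and
    \<open>t / (s + t)\<close>.\<close>
  have conv: "((u + v) / (s + t)) powr r
      \<le> s / (s + t) * (u powr r / s powr r) + t / (s + t) * (v powr r / t powr r)"
    if "0 \<le> u" "0 \<le> v" for u v
  proof -
    have "(u + v) / (s + t) = s / (s + t) * (u / s) + t / (s + t) * (v / t)"
      using st by (simp add: add_divide_distrib)
    moreover have "(s / (s + t) * (u / s) + t / (s + t) * (v / t)) powr r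
        \<le> s / (s + t) * (u / s) powr r + t / (s + t) * (v / t) powr r"
      using convex_onD[OF convex_on_powr_nonneg[OF r], of "t / (s + t)" "u / s" "v / t"] st that
      by (simp add: field_simps)
    ultimately show ?thesis using st that by (simp add: powr_divide)
  qed
  have "((a + c) / (s + t)) powr r + ((b + d) / (s + t)) powr r
      \<le> s / (s + t) * ((a powr r + b powr r) / s powr r)
        + t / (s + t) * ((c powr r + d powr r) / t powr r)"
    using conv[of a c] conv[of b d] nn by (simp add: algebra_simps add_divide_distrib)
  also have "\<dots> = 1"
  proof -
    \<comment> \<open>By the choice of \<open>s\<close> and \<open>t\<close> both quotients equal 1,
      leaving only the sum of the weights.\<close>
    have "a powr r + b powr r = s powr r" "c powr r + d powr r = t powr r"
      using r by (simp_all add: s_def t_def pnorm2_powr)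
    then show ?thesis using st by (simp add: add_divide_distrib[symmetric])
  qed
  finally have "(a + c) powr r + (b + d) powr r \<le> (s + t) powr r"
    using st nn by (simp add: powr_divide add_divide_distrib[symmetric] divide_simps)
  then have "pnorm2 r (a + c) (b + d) \<le> ((s + t) powr r) powr (1 / r)"
    unfolding pnorm2_def using r by (intro powr_mono2) auto
  also have "\<dots> = s + t" using st r by (simp add: powr_powr)
  finally show ?thesis by (simp add: s_def t_def)
qed

lemma dist_p_infinity: "dist_p \<infinity> x y = max (excess_sum x y) (excess_sum y x)"
  by (simp add: dist_p_def deficit_sum_eq)

lemma dist_p_ereal: "dist_p (ereal r) x y = pnorm2 r (excess_sum x y) (excess_sum y x)"
  by (simp add: dist_p_def deficit_sum_eq pnorm2_def)

theorem theorem3p3: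
  fixes p :: ereal
  assumes "1 \<le> p"
  shows "Metric_space (UNIV :: (real ^ 'k) set) (dist_p p)"
proof (cases p)
  case PInf
  show ?thesis
    unfolding PInf
  proof
    fix x y z :: "real ^ 'k"
    show "0 \<le> dist_p \<infinity> x y"
      by (simp add: dist_p_infinity le_max_iff_disj excess_sum_nonneg)
    show "dist_p \<infinity> x y = dist_p \<infinity> y x"
      by (simp add: dist_p_infinity max.commute)
    show "dist_p \<infinity> x y = 0 \<longleftrightarrow> x = y"
      using excess_sum_nonneg[of x y] excess_sum_nonneg[of y x] excess_sums_eq_0_iff[of x y]
      by (auto simp: dist_p_infinity max_def split: if_splits)
    show "dist_p \<infinity> x z \<le> dist_p \<infinity> x y + dist_p \<infinity> y z"
      \<comment> \<open>The second instance runs from \<open>z\<close> to \<open>x\<close> through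
        \<open>y\<close> and bounds the other entry of the maximum.\<close>
      using excess_sum_triangle[of x z y] excess_sum_triangle[of z x y]
      by (auto simp: dist_p_infinity)
  qed
next
  case (real r)
  with assms have r: "1 \<le> r" by simp
  show ?thesis
    unfolding real
  proof
    fix x y z :: "real ^ 'k"
    show "0 \<le> dist_p (ereal r) x y"
      by (simp add: dist_p_ereal pnorm2_nonneg)
    show "dist_p (ereal r) x y = dist_p (ereal r) y x"
      by (simp add: dist_p_ereal pnorm2_def add.commute)
    show "dist_p (ereal r) x y = 0 \<longleftrightarrow> x = y"
      by (simp add: dist_p_ereal pnorm2_eq_0_iff excess_sums_eq_0_iff)
    \<comment> \<open>Monotonicity of the norm passes from the triangle inequalities of the two
      entries to a sum of pairs, to which Minkowski's inequality applies.\<close>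
    have "dist_p (ereal r) x z
        \<le> pnorm2 r (excess_sum x y + excess_sum y z) (excess_sum y x + excess_sum z y)"
      unfolding dist_p_ereal
      using r excess_sum_triangle[of x z y] excess_sum_triangle[of z x y]
      by (intro pnorm2_mono) (auto simp: excess_sum_nonneg)
    also have "\<dots> \<le> dist_p (ereal r) x y + dist_p (ereal r) y z"
      unfolding dist_p_ereal using r by (intro minkowski_pnorm2 excess_sum_nonneg)
    finally show "dist_p (ereal r) x z \<le> dist_p (ereal r) x y + dist_p (ereal r) y z" .
  qed
next
  case MInf
  with assms show ?thesis by simp
qed

end
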